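(* Let $T>0$, $N\in\mathbb N$ and $\Delta t=T/N$. Given source functions $f_i^{\mathrm{orig}}$, $1\le i\le K$, of the evolution equation $\mathcal P_iu=f_i^{\mathrm{orig}}$, set $g_i=\mathcal T_{\mathrm{disc}}(f_i^{\mathrm{orig}})$ and let $v=(v_1,\dots,v_K)$ be a solution of the finite difference system $$\mathsf P_iv(t,x)=g_i(t,x),\qquad 1\le i\le K,$$ computed at times $t_n=n\Delta t$ for $0\le n<N$. Define $u_i(t,x)=\mathcal I_{\mathrm{disc}}(v_i(\cdot,x))(t)$. Then, for $0<t<T$, $u=(u_1,\dots,u_K)$ solves $$\mathcal P_iu(t,x)=\mathcal I_{\mathrm{disc}}\big(\mathcal T_{\mathrm{disc}}(f_i^{\mathrm{orig}}(\cdot,x))\big)(t),\qquad 1\le i\le K,$$ that is, $u$ solves the evolution equation with $f_i^{\mathrm{orig}}$ replaced by $\mathcal I_{\mathrm{disc}}(\mathcal T_{\mathrm{disc}}(f_i^{\mathrm{orig}}(\cdot,x)))(t)$.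
   Context: **Evolution equation.** Let $X\subset\mathbb R^d$ and let $u=(u_1,\dots,u_K)$ be a vector-valued function of $(t,x)\in\mathbb R\times X$. Define $$\mathcal P_i u(t,x)=\partial_t^{n_i}u_i(t,x)+\sum_{j=0}^{n_i-1}\sum_{k=1}^K\partial_t^jL_{ijk}u_k(t,x),\qquad 1\le i\le K,$$ where the $L_{ijk}$ are linear spatial operators (acting in $x$ only, possibly depending on $x$, independent of $t$, so that $\partial_t$ and $L_{ijk}$ commute). The evolution equation is $\mathcal P_iu=f_i$, $1\le i\le K$, assumed well posed under the initial condition $u\equiv0$ for $t\le0$ and appropriate spatial conditions; source functions vanish for $t\le 0$ and have sufficient decay as $t\to\infty$. **Finite difference operators.** $\mathsf D v(t,x)=\sum_{n\in Z}c_{1,n}v(t+n\Delta t,x)$, where $Z$ is a finite set (usually of integers or half-integers) and the coefficients $c_{1,n}$ are chosen so that $\mathsf D$ approximates $\partial_t$. Let $\mathsf D^j$ be the $j$-fold composition of $\mathsf D$, and $$\mathsf P_iv(t,x)=\mathsf D^{n_i}v_i(t,x)+\sum_{j=0}^{n_i-1}\sum_{k=1}^K\mathsf D^jL_{ijk}v_k(t,x),\qquad 1\le i\le K,$$ with the same $L_{ijk}$. Unless stated otherwise, the finite difference system is solved with the initial condition $v(t,x)\equiv0$ for $t\le0$. The step $\Delta t$ is assumed small enough (depending on the $L_{ijk}$) that the finite difference system is numerically stable. **Phase shift function.** $q(\omega)=\frac1{2\pi i}\sum_{n\in Z} c_{1,n}e^{2\pi i n\omega\Delta t}$. It is assumed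 that $q$ is real-valued, and $q$ is restricted to the largest subset $\Omega=\Omega(\Delta t)\subset\mathbb R$ containing the origin on which $q:\Omega\to q(\Omega)$ is invertible. Both $\Omega$ and $q(\Omega)$ are assumed to exhaust $\mathbb R$ as $\Delta t\to0$. **Discrete transforms.** Let $S=\{n\Delta t:0\le n<N\}$ and choose a partition of $\Omega$ by points $\omega_m\in\Omega$ with constant spacing $\Delta\omega=\omega_{m+1}-\omega_m$. For a function $f(t)$, $t\in[0,T]$, with known values on $S$, put $$a_m(f)=\Delta t\sum_{n=0}^{N-1}f(n\Delta t)e^{-2\pi i n\Delta t\,\omega_m},\qquad b_m(f)=\Delta t\sum_{n=0}^{N-1}f(n\Delta t)e^{-2\pi i n\Delta t\,q(\omega_m)},$$ and define functions of the continuous variable $t\in[0,T]$ by $$\mathcal I_{\mathrm{disc}}(f)(t)=\Delta\omega\sum_{\omega_m\in\Omega}a_m(f)e^{2\pi i q(\omega_m)t}q'(\omega_m),\qquad \mathcal T_{\mathrm{disc}}(f)(t)=\Delta\omega\sum_{\omega_m\in\Omega}b_m(f)e^{2\pi i\omega_mt}.$$ For functions of $(t,x)$ the transforms are applied in $t$ with $x$ fixed.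
   Formalization: Added: v vanishes at grid times t_n ≥ T, and P_i v = 0 at grid times outside 0 ≤ n < N (the claim fails otherwise through end-of-window terms); at grid times the system involves only grid times, so no odd powers of D with half-integer Z. *)

theory Defs
  imports "HOL-Analysis.Analysis"
begin

text \<open>
  Functions of time and space are curried, \<open>v k t x\<close> being the \<open>k\<close>-th component at time \<open>t\<close> and
  position \<open>x\<close>; the components are indexed by a finite type, so \<open>K\<close> is its cardinality.
\<close>

subsection \<open>Spatial operators\<close>

definition function_space :: "('a \<Rightarrow> complex) set \<Rightarrow> bool" where
  "function_space V \<longleftrightarrow>
     (\<lambda>x. 0) \<in> V \<and>
     (\<forall>f\<in>V. \<forall>g\<in>V. (\<lambda>x. f x + g x) \<in> V) \<and>
     (\<forall>a. \<forall>f\<in>V. (\<lambda>x. a * f x) \<in> V)"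

text \<open>
  The operator need only be defined on a space \<open>V\<close> of admissible functions: differential operators
  do not act on arbitrary functions, and \<open>V\<close> can also carry homogeneous spatial boundary conditions.
  Functions on \<open>X\<close> are represented by functions on the whole type, whence the first conjunct.
\<close>

definition linear_operator ::
    "'a set \<Rightarrow> ('a \<Rightarrow> complex) set \<Rightarrow> (('a \<Rightarrow> complex) \<Rightarrow> 'a \<Rightarrow> complex) \<Rightarrow> bool" where
  "linear_operator X V A \<longleftrightarrow>
     (\<forall>f\<in>V. \<forall>g\<in>V. (\<forall>x\<in>X. f x = g x) \<longrightarrow> (\<forall>x\<in>X. A f x = A g x)) \<and>
     (\<forall>f\<in>V. \<forall>g\<in>V. \<forall>x\<in>X. A (\<lambda>y. f y + g y) x = A f x + A g x) \<and>
     (\<forall>a. \<forall>f\<in>V. \<forall>x\<in>X. A (\<lambda>y. a * f y) x = a * A f x)"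


subsection \<open>The evolution equation\<close>

definition time_deriv :: "nat \<Rightarrow> (real \<Rightarrow> complex) \<Rightarrow> real \<Rightarrow> complex" where
  "time_deriv j = (\<lambda>f t. vector_derivative f (at t)) ^^ j"

definition times_differentiable_on :: "nat \<Rightarrow> (real \<Rightarrow> complex) \<Rightarrow> real set \<Rightarrow> bool" where
  "times_differentiable_on n f I \<longleftrightarrow> (\<forall>j<n. \<forall>t\<in>I. time_deriv j f differentiable (at t))"

definition evolution_op ::
    "('k::finite \<Rightarrow> nat) \<Rightarrow> ('k \<Rightarrow> nat \<Rightarrow> 'k \<Rightarrow> ('a \<Rightarrow> complex) \<Rightarrow> 'a \<Rightarrow> complex)
      \<Rightarrow> 'k \<Rightarrow> ('k \<Rightarrow> real \<Rightarrow> 'a \<Rightarrow> complex) \<Rightarrow> real \<Rightarrow> 'a \<Rightarrow> complex" where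
  "evolution_op ord L i u t x =
     time_deriv (ord i) (\<lambda>s. u i s x) t
     + (\<Sum>j<ord i. \<Sum>k\<in>UNIV. time_deriv j (\<lambda>s. L i j k (u k s) x) t)"

text \<open>
  The differentiability conjuncts are needed because \<^const>\<open>vector_derivative\<close> is total.
\<close>

definition solves_evolution ::
    "'a set \<Rightarrow> ('k \<Rightarrow> ('a \<Rightarrow> complex) set) \<Rightarrow> ('k::finite \<Rightarrow> nat)
      \<Rightarrow> ('k \<Rightarrow> nat \<Rightarrow> 'k \<Rightarrow> ('a \<Rightarrow> complex) \<Rightarrow> 'a \<Rightarrow> complex)
      \<Rightarrow> real set \<Rightarrow> ('k \<Rightarrow> real \<Rightarrow> 'a \<Rightarrow> complex) \<Rightarrow> ('k \<Rightarrow> real \<Rightarrow> 'a \<Rightarrow> complex) \<Rightarrow> bool" where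
  "solves_evolution X V ord L I f u \<longleftrightarrow>
     (\<forall>k. \<forall>t\<in>I. u k t \<in> V k) \<and>
     (\<forall>i. \<forall>x\<in>X.
        times_differentiable_on (ord i) (\<lambda>s. u i s x) I \<and>
        (\<forall>j<ord i. \<forall>k. times_differentiable_on j (\<lambda>s. L i j k (u k s) x) I) \<and>
        (\<forall>t\<in>I. evolution_op ord L i u t x = f i t x))"


subsection \<open>Finite differences\<close>

text \<open>\<open>Z\<close> is a set of reals in order to allow, e.g., half-integer offsets; \<open>h\<close> is the time step.\<close>

definition fd_deriv ::
    "real set \<Rightarrow> (real \<Rightarrow> complex) \<Rightarrow> real \<Rightarrow> (real \<Rightarrow> complex) \<Rightarrow> real \<Rightarrow> complex" where
  "fd_deriv Z c h w t = (\<Sum>z\<in>Z. c z * w (t + z * h))"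

definition fd_op ::
    "real set \<Rightarrow> (real \<Rightarrow> complex) \<Rightarrow> real \<Rightarrow> ('k::finite \<Rightarrow> nat)
      \<Rightarrow> ('k \<Rightarrow> nat \<Rightarrow> 'k \<Rightarrow> ('a \<Rightarrow> complex) \<Rightarrow> 'a \<Rightarrow> complex)
      \<Rightarrow> 'k \<Rightarrow> ('k \<Rightarrow> real \<Rightarrow> 'a \<Rightarrow> complex) \<Rightarrow> real \<Rightarrow> 'a \<Rightarrow> complex" where
  "fd_op Z c h ord L i v t x =
     (fd_deriv Z c h ^^ ord i) (\<lambda>s. v i s x) t
     + (\<Sum>j<ord i. \<Sum>k\<in>UNIV. (fd_deriv Z c h ^^ j) (\<lambda>s. L i j k (v k s) x) t)"

text \<open>\<open>offsets Z j\<close> contains the time offsets, in units of the step, in the \<open>j\<close>-fold difference.\<close>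

primrec offsets :: "real set \<Rightarrow> nat \<Rightarrow> real set" where
  "offsets Z 0 = {0}"
| "offsets Z (Suc j) = {z + s | z s. z \<in> Z \<and> s \<in> offsets Z j}"

text \<open>
  The system can be solved on the time grid only if, at a grid time, it involves no values at other
  times. This is automatic for integer offsets; for half-integer offsets it says that only
  differences of even order occur.
\<close>

definition grid_system ::
    "'a set \<Rightarrow> ('k \<Rightarrow> ('a \<Rightarrow> complex) set) \<Rightarrow> real set \<Rightarrow> ('k::finite \<Rightarrow> nat)
      \<Rightarrow> ('k \<Rightarrow> nat \<Rightarrow> 'k \<Rightarrow> ('a \<Rightarrow> complex) \<Rightarrow> 'a \<Rightarrow> complex) \<Rightarrow> bool" where
  "grid_system X V Z ord L \<longleftrightarrow>
     (\<forall>i. offsets Z (ord i) \<subseteq> \<int> \<and>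
       (\<forall>j<ord i. \<forall>k. (\<exists>w\<in>V k. \<exists>x\<in>X. L i j k w x \<noteq> 0) \<longrightarrow> offsets Z j \<subseteq> \<int>))"


subsection \<open>Phase shift function and discrete transforms\<close>

definition phase_symbol :: "real set \<Rightarrow> (real \<Rightarrow> complex) \<Rightarrow> real \<Rightarrow> real \<Rightarrow> complex" where
  "phase_symbol Z c h \<omega> = 1 / (2 * pi * \<i>) * (\<Sum>z\<in>Z. c z * exp (2 * pi * \<i> * z * \<omega> * h))"

text \<open>The largest subset on which \<open>q\<close> is invertible is understood as the largest interval.\<close>

definition phase_domain :: "(real \<Rightarrow> real) \<Rightarrow> real set \<Rightarrow> bool" where
  "phase_domain q \<Omega> \<longleftrightarrow>
     is_interval \<Omega> \<and> 0 \<in> \<Omega> \<and> inj_on q \<Omega> \<and>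
     (\<forall>J. is_interval J \<and> 0 \<in> J \<and> inj_on q J \<longrightarrow> J \<subseteq> \<Omega>)"

text \<open>
  The points are \<open>\<omega> 0, \<dots>, \<omega> (M - 1)\<close>. Whether the end points of the domain are among them is left
  open, as this is a matter of the quadrature rule.
\<close>

definition uniform_partition :: "real set \<Rightarrow> nat \<Rightarrow> real \<Rightarrow> (nat \<Rightarrow> real) \<Rightarrow> bool" where
  "uniform_partition \<Omega> M \<Delta>\<omega> \<omega> \<longleftrightarrow>
     0 < \<Delta>\<omega> \<and> (\<forall>m<M. \<omega> m \<in> \<Omega>) \<and> (\<forall>m. Suc m < M \<longrightarrow> \<omega> (Suc m) - \<omega> m = \<Delta>\<omega>)"

text \<open>
  The sum runs over the time window \<open>0 \<le> n < N\<close>, as if the function vanished at all other grid times.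
  Finite differences near the ends of the window do involve such times, so a shift of the summation
  index is exact only for functions that do vanish there.
\<close>

definition sampled_fourier :: "real \<Rightarrow> nat \<Rightarrow> (real \<Rightarrow> complex) \<Rightarrow> real \<Rightarrow> complex" where
  "sampled_fourier h N f \<xi> =
     h * (\<Sum>n<N. f (real n * h) * exp (- 2 * pi * \<i> * real n * h * \<xi>))"

definition I_disc ::
    "real \<Rightarrow> nat \<Rightarrow> (real \<Rightarrow> real) \<Rightarrow> nat \<Rightarrow> real \<Rightarrow> (nat \<Rightarrow> real) \<Rightarrow> (real \<Rightarrow> complex) \<Rightarrow> real \<Rightarrow> complex" where
  "I_disc h N q M \<Delta>\<omega> \<omega> f t =
     \<Delta>\<omega> * (\<Sum>m<M. sampled_fourier h N f (\<omega> m) * exp (2 * pi * \<i> * q (\<omega> m) * t) * deriv q (\<omega> m))"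

definition T_disc ::
    "real \<Rightarrow> nat \<Rightarrow> (real \<Rightarrow> real) \<Rightarrow> nat \<Rightarrow> real \<Rightarrow> (nat \<Rightarrow> real) \<Rightarrow> (real \<Rightarrow> complex) \<Rightarrow> real \<Rightarrow> complex" where
  "T_disc h N q M \<Delta>\<omega> \<omega> f t =
     \<Delta>\<omega> * (\<Sum>m<M. sampled_fourier h N f (q (\<omega> m)) * exp (2 * pi * \<i> * \<omega> m * t))"

end

theory Submission imports Defs begin

text \<open>
  In the frequency domain the finite difference system and the evolution equation are the same
  algebraic system. The exponential of frequency \<open>\<xi>\<close> is an eigenfunction of the difference operator
  with eigenvalue \<open>2 \<pi> i q(\<xi>)\<close> (\<open>fd_deriv_funpow_exp\<close>), and differentiation has this same eigenvalue
  on the exponential of frequency \<open>q(\<xi>)\<close>. Now \<^const>\<open>I_disc\<close> analyses with the former exponentials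
  and synthesises with the latter; hence it turns \<open>j\<close>-fold differences in its argument into
  \<open>j\<close>-fold derivatives of the result.

  On the synthesis side this is the differentiation of a finite sum of exponentials
  (\<open>time_deriv_I_disc\<close>). On the analysis side it is a summation by parts, in which a boundary term
  could spoil the identity: a difference near the ends of the time window reaches beyond it. The sums
  are therefore taken over all of \<open>\<int>\<close>, where translating the index is exact
  (\<open>fd_deriv_funpow_has_sum\<close>). That changes no sum, since \<open>v\<close> vanishes at the grid times outside the
  window, and so does the left-hand side of the difference system. The individual differences
  need not vanish there, so the restriction to the window is possible only after they have been added
  up to the full operator (\<open>grid_system_sampled_fourier\<close>).

  Finally \<^const>\<open>I_disc\<close> is, at each time, a fixed finite linear combination of the samples of
  its argument, so it commutes with the spatial operators (\<open>linear_operator_I_disc\<close>). Multiplying the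
  equation in the frequency domain by the synthesis weights and adding over the partition gives
  the evolution equation with source \<open>\<I>(g)\<close>.
\<close>

section \<open>Spatial operators and linear combinations\<close>

lemma function_space_zero: "function_space V \<Longrightarrow> (\<lambda>x. 0) \<in> V"
  and function_space_add: "function_space V \<Longrightarrow> f \<in> V \<Longrightarrow> g \<in> V \<Longrightarrow> (\<lambda>x. f x + g x) \<in> V"
  and function_space_scale: "function_space V \<Longrightarrow> f \<in> V \<Longrightarrow> (\<lambda>x. a * f x) \<in> V"
  by (simp_all add: function_space_def)

lemma linear_operator_cong:
    "linear_operator X V A \<Longrightarrow> f \<in> V \<Longrightarrow> g \<in> V \<Longrightarrow> (\<And>x. x \<in> X \<Longrightarrow> f x = g x) \<Longrightarrow> x \<in> X
      \<Longrightarrow> A f x = A g x"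
  and linear_operator_add:
    "linear_operator X V A \<Longrightarrow> f \<in> V \<Longrightarrow> g \<in> V \<Longrightarrow> x \<in> X
      \<Longrightarrow> A (\<lambda>y. f y + g y) x = A f x + A g x"
  and linear_operator_scale:
    "linear_operator X V A \<Longrightarrow> f \<in> V \<Longrightarrow> x \<in> X \<Longrightarrow> A (\<lambda>y. a * f y) x = a * A f x"
  unfolding linear_operator_def by blast+

lemma function_space_lincomb:
  assumes V: "function_space V" and "finite S" "\<And>n. n \<in> S \<Longrightarrow> w n \<in> V"
  shows "(\<lambda>y. \<Sum>n\<in>S. a n * w n y) \<in> V"
  using assms(2,3)
proof (induction S rule: finite_induct)
  case empty
  then show ?case using function_space_zero[OF V] by simp
next
  case (insert n S)
  have "w n \<in> V" using insert.prems by blast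
  moreover have "(\<lambda>y. \<Sum>n\<in>S. a n * w n y) \<in> V"
    by (rule insert.IH) (use insert.prems in blast)
  ultimately have "(\<lambda>y. a n * w n y + (\<Sum>n\<in>S. a n * w n y)) \<in> V"
    by (intro function_space_add[OF V] function_space_scale[OF V])
  then show ?case using insert.hyps by simp
qed

lemma linear_operator_zero:
  assumes V: "function_space V" and A: "linear_operator X V A"
    and f: "f \<in> V" "\<And>y. y \<in> X \<Longrightarrow> f y = 0" and x: "x \<in> X"
  shows "A f x = 0"
proof -
  have "A f x = A (\<lambda>y. 0 * f y) x"
    by (rule linear_operator_cong[OF A f(1) function_space_scale[OF V f(1)] _ x]) (simp add: f(2))
  also have "\<dots> = 0 * A f x"
    by (rule linear_operator_scale[OF A f(1) x])
  finally show ?thesis by simp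
qed

lemma linear_operator_lincomb:
  assumes V: "function_space V" and A: "linear_operator X V A"
    and "finite S" "\<And>n. n \<in> S \<Longrightarrow> w n \<in> V" and x: "x \<in> X"
  shows "A (\<lambda>y. \<Sum>n\<in>S. a n * w n y) x = (\<Sum>n\<in>S. a n * A (w n) x)"
  using assms(3,4)
proof (induction S rule: finite_induct)
  case empty
  show ?case
    using linear_operator_zero[OF V A function_space_zero[OF V] _ x] by simp
next
  case (insert n S)
  have w: "w n \<in> V" and S: "(\<lambda>y. \<Sum>n\<in>S. a n * w n y) \<in> V"
    using insert.prems by (blast, intro function_space_lincomb[OF V insert.hyps(1)], blast)
  have "A (\<lambda>y. a n * w n y + (\<Sum>n\<in>S. a n * w n y)) x
      = A (\<lambda>y. a n * w n y) x + A (\<lambda>y. \<Sum>n\<in>S. a n * w n y) x"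
    by (rule linear_operator_add[OF A function_space_scale[OF V w] S x])
  moreover have "A (\<lambda>y. a n * w n y) x = a n * A (w n) x"
    by (rule linear_operator_scale[OF A w x])
  moreover have "A (\<lambda>y. \<Sum>n\<in>S. a n * w n y) x = (\<Sum>n\<in>S. a n * A (w n) x)"
    by (rule insert.IH) (use insert.prems in blast)
  ultimately show ?case using insert.hyps by simp
qed


section \<open>Powers of the difference operator\<close>

lemma finite_offsets: "finite Z \<Longrightarrow> finite (offsets Z j)"
proof (induction j)
  case (Suc j)
  have "offsets Z (Suc j) = (\<lambda>(z, s). z + s) ` (Z \<times> offsets Z j)" by auto
  with Suc show ?case by simp
qed simp

text \<open>
  Collecting the terms with equal total offset makes the coefficients \<open>b\<close> the \<open>j\<close>-fold convolution
  power of \<open>c\<close>. As they depend on neither \<open>w\<close> nor \<open>t\<close>, they can be identified by testing on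
  exponentials.
\<close>
lemma fd_deriv_funpow_expansion:
  assumes Z: "finite Z"
  shows "\<exists>b. \<forall>w t. (fd_deriv Z c h ^^ j) w t = (\<Sum>s\<in>offsets Z j. b s * w (t + s * h))"
proof (induction j)
  case 0
  show ?case by (intro exI[of _ "\<lambda>s. 1"]) simp
next
  case (Suc j)
  then obtain b where b: "\<And>w t. (fd_deriv Z c h ^^ j) w t = (\<Sum>s\<in>offsets Z j. b s * w (t + s * h))"
    by blast
  let ?P = "Z \<times> offsets Z j" and ?add = "\<lambda>(z, s). z + (s::real)"
  have fin: "finite ?P" using Z finite_offsets by blast
  have im: "offsets Z (Suc j) = ?add ` ?P" by auto
  define b' where "b' r = (\<Sum>p \<in> {p \<in> ?P. ?add p = r}. c (fst p) * b (snd p))" for r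
  have "(fd_deriv Z c h ^^ Suc j) w t = (\<Sum>r\<in>offsets Z (Suc j). b' r * w (t + r * h))" for w t
  proof -
    have "(fd_deriv Z c h ^^ Suc j) w t
        = (\<Sum>p\<in>?P. c (fst p) * b (snd p) * w (t + ?add p * h))"
      by (simp add: fd_deriv_def b sum_distrib_left sum.cartesian_product split_beta algebra_simps)
    also have "\<dots> = (\<Sum>r\<in>?add ` ?P. \<Sum>p \<in> {p \<in> ?P. ?add p = r}.
        c (fst p) * b (snd p) * w (t + ?add p * h))"
      by (rule sum.image_gen[OF fin])
    also have "\<dots> = (\<Sum>r\<in>?add ` ?P. b' r * w (t + r * h))"
      unfolding b'_def sum_distrib_right by (intro sum.cong refl) auto
    finally show ?thesis by (simp only: im)
  qed
  then show ?case by blast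
qed

text \<open>
  Exponentials are eigenfunctions of the difference operator, and the phase shift function is
  defined so that the eigenvalue is the one that differentiation has at the frequency \<open>q \<xi>\<close>.
\<close>
lemma fd_deriv_funpow_exp:
  "(fd_deriv Z c h ^^ j) (\<lambda>t. exp (2 * pi * \<i> * \<xi> * t)) t
     = (2 * pi * \<i> * phase_symbol Z c h \<xi>) ^ j * exp (2 * pi * \<i> * \<xi> * t)"
proof (induction j arbitrary: t)
  case (Suc j)
  let ?\<sigma> = "2 * pi * \<i> * phase_symbol Z c h \<xi>"
  have \<sigma>: "?\<sigma> = (\<Sum>z\<in>Z. c z * exp (2 * pi * \<i> * z * \<xi> * h))"
    by (simp add: phase_symbol_def)
  have "(fd_deriv Z c h ^^ Suc j) (\<lambda>t. exp (2 * pi * \<i> * \<xi> * t)) t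
      = (\<Sum>z\<in>Z. c z * (?\<sigma> ^ j * exp (2 * pi * \<i> * \<xi> * of_real (t + z * h))))"
    by (simp only: funpow.simps o_apply fd_deriv_def Suc)
  also have "\<dots> = (\<Sum>z\<in>Z. ?\<sigma> ^ j * exp (2 * pi * \<i> * \<xi> * t)
      * (c z * exp (2 * pi * \<i> * z * \<xi> * h)))"
    by (intro sum.cong refl) (simp add: exp_add[symmetric] algebra_simps)
  also have "\<dots> = ?\<sigma> ^ j * exp (2 * pi * \<i> * \<xi> * t) * ?\<sigma>"
    unfolding \<sigma> by (rule sum_distrib_left[symmetric])
  finally show ?case by (simp add: algebra_simps)
qed simp


section \<open>Differences on the time grid\<close>

lemma has_sum_finite_sum:
  fixes f :: "'i \<Rightarrow> 'b \<Rightarrow> 'c::topological_comm_monoid_add"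
  assumes "\<And>i. i \<in> I \<Longrightarrow> (f i has_sum S i) A"
  shows "((\<lambda>x. \<Sum>i\<in>I. f i x) has_sum (\<Sum>i\<in>I. S i)) A"
  using assms by (induction I rule: infinite_finite_induct) (auto intro: has_sum_add)

text \<open>
  Over the whole of \<open>\<int>\<close> a translation of the samples only produces a phase factor, with no
  boundary terms.
\<close>
lemma has_sum_int_shift:
  fixes w :: "real \<Rightarrow> complex" and h s \<xi> :: real
  assumes sum: "((\<lambda>n::int. w (real_of_int n * h) * exp (- 2 * pi * \<i> * of_int n * h * \<xi>)) has_sum S) UNIV"
    and s: "s \<in> \<int>"
  shows "((\<lambda>n::int. w (real_of_int n * h + s * h) * exp (- 2 * pi * \<i> * of_int n * h * \<xi>))
    has_sum exp (2 * pi * \<i> * \<xi> * of_real (s * h)) * S) UNIV"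
proof -
  obtain m where m: "s = of_int m" using s by (elim Ints_cases)
  have "((\<lambda>n::int. exp (2 * pi * \<i> * \<xi> * of_real (s * h)) *
      (w (real_of_int (n + m) * h) * exp (- 2 * pi * \<i> * of_int (n + m) * h * \<xi>)))
      has_sum exp (2 * pi * \<i> * \<xi> * of_real (s * h)) * S) UNIV"
    by (intro has_sum_cmult_right
      has_sum_reindex_bij_betw[THEN iffD2, OF bij_plus_right[of m] sum])
  also have "(\<lambda>n::int. exp (2 * pi * \<i> * \<xi> * of_real (s * h)) *
      (w (real_of_int (n + m) * h) * exp (- 2 * pi * \<i> * of_int (n + m) * h * \<xi>)))
    = (\<lambda>n::int. w (real_of_int n * h + s * h) * exp (- 2 * pi * \<i> * of_int n * h * \<xi>))"
  proof
    fix n :: int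
    have "exp (2 * pi * \<i> * \<xi> * of_real (s * h)) * exp (- 2 * pi * \<i> * of_int (n + m) * h * \<xi>)
        = exp (- 2 * pi * \<i> * of_int n * h * \<xi>)"
      by (simp add: m exp_add[symmetric] algebra_simps)
    then show "exp (2 * pi * \<i> * \<xi> * of_real (s * h)) *
      (w (real_of_int (n + m) * h) * exp (- 2 * pi * \<i> * of_int (n + m) * h * \<xi>))
      = w (real_of_int n * h + s * h) * exp (- 2 * pi * \<i> * of_int n * h * \<xi>)"
      by (simp add: m distrib_right mult.left_commute)
  qed
  finally show ?thesis .
qed

text \<open>
  Replaces the time window by the whole grid, where translations are harmless.
\<close>
lemma sampled_fourier_has_sum:
  assumes "\<And>n::int. n < 0 \<or> int N \<le> n \<Longrightarrow> w (real_of_int n * h) = 0"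
  shows "((\<lambda>n::int. h * (w (real_of_int n * h) * exp (- 2 * pi * \<i> * of_int n * h * \<xi>)))
    has_sum sampled_fourier h N w \<xi>) UNIV"
proof -
  let ?f = "\<lambda>n::int. h * (w (real_of_int n * h) * exp (- 2 * pi * \<i> * of_int n * h * \<xi>))"
  have "sampled_fourier h N w \<xi> = (\<Sum>n\<in>int ` {..<N}. ?f n)"
    by (simp add: sampled_fourier_def sum.reindex sum_distrib_left)
  then have "(?f has_sum sampled_fourier h N w \<xi>) (int ` {..<N})"
    by (intro has_sum_finiteI) simp_all
  moreover have zero: "?f n = 0" if "n \<notin> int ` {..<N}" for n
    using assms[of n] that by (cases n) (auto simp: image_iff not_less)
  have "(?f has_sum S) UNIV \<longleftrightarrow> (?f has_sum S) (int ` {..<N})" for S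
    by (rule has_sum_cong_neutral) (use zero in blast)+
  ultimately show ?thesis by blast
qed

text \<open>
  The discrete counterpart of \<open>\<F>(w') = 2 \<pi> i \<xi> \<F>(w)\<close>, the true symbol of the difference
  operator taking the place of \<open>2 \<pi> i \<xi>\<close>. The offsets must be integers for the difference to be
  determined by the samples at all.
\<close>
lemma fd_deriv_funpow_has_sum:
  assumes Z: "finite Z" and int: "offsets Z j \<subseteq> \<int>"
    and w: "\<And>n::int. n < 0 \<or> int N \<le> n \<Longrightarrow> w (real_of_int n * h) = 0"
  shows "((\<lambda>n::int. h * ((fd_deriv Z c h ^^ j) w (real_of_int n * h)
        * exp (- 2 * pi * \<i> * of_int n * h * \<xi>)))
    has_sum (2 * pi * \<i> * phase_symbol Z c h \<xi>) ^ j * sampled_fourier h N w \<xi>) UNIV"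
proof -
  obtain b where b: "\<And>w t. (fd_deriv Z c h ^^ j) w t = (\<Sum>s\<in>offsets Z j. b s * w (t + s * h))"
    using fd_deriv_funpow_expansion[OF Z] by blast
  \<comment> \<open>Evaluating the expansion on an exponential at time \<open>0\<close> expresses the symbol through \<open>b\<close>.\<close>
  have symbol: "(2 * pi * \<i> * phase_symbol Z c h \<xi>) ^ j
      = (\<Sum>s\<in>offsets Z j. b s * exp (2 * pi * \<i> * \<xi> * of_real (s * h)))"
    using fd_deriv_funpow_exp[of j Z c h \<xi> 0] by (simp add: b)
  have "((\<lambda>n::int. \<Sum>s\<in>offsets Z j. b s * (h * w (real_of_int n * h + s * h)
        * exp (- 2 * pi * \<i> * of_int n * h * \<xi>)))
    has_sum (\<Sum>s\<in>offsets Z j. b s * (exp (2 * pi * \<i> * \<xi> * of_real (s * h)) * sampled_fourier h N w \<xi>))) UNIV"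
  proof (intro has_sum_finite_sum has_sum_cmult_right)
    fix s assume "s \<in> offsets Z j"
    then have s: "s \<in> \<int>" using int by blast
    show "((\<lambda>n::int. h * w (real_of_int n * h + s * h) * exp (- 2 * pi * \<i> * of_int n * h * \<xi>))
      has_sum exp (2 * pi * \<i> * \<xi> * of_real (s * h)) * sampled_fourier h N w \<xi>) UNIV"
      using has_sum_int_shift[where w = "\<lambda>t. h * w t", OF _ s]
        sampled_fourier_has_sum[where w = w and N = N and \<xi> = \<xi>, OF w]
      by (simp add: mult.assoc)
  qed
  then show ?thesis
    unfolding symbol b by (simp add: sum_distrib_left sum_distrib_right mult_ac)
qed


section \<open>The transform of the solution\<close>

lemma I_disc_as_samples:
  obtains \<kappa> where "\<And>f t. I_disc h N q M \<Delta>\<omega> \<omega> f t = (\<Sum>n<N. \<kappa> t n * f (real n * h))"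
proof
  fix f t
  show "I_disc h N q M \<Delta>\<omega> \<omega> f t = (\<Sum>n<N. (\<Sum>m<M. \<Delta>\<omega> * h * exp (- 2 * pi * \<i> * real n * h * \<omega> m)
     * exp (2 * pi * \<i> * q (\<omega> m) * t) * deriv q (\<omega> m)) * f (real n * h))"
    unfolding I_disc_def sampled_fourier_def sum_distrib_left sum_distrib_right
    by (subst sum.swap) (intro sum.cong refl, simp add: mult_ac)
qed

text \<open>
  Commutation reduces to linearity, because only finitely many samples enter.
\<close>
lemma linear_operator_I_disc:
  assumes V: "function_space V" and A: "linear_operator X V A" and v: "\<And>t. v t \<in> V" and x: "x \<in> X"
  shows "A (\<lambda>y. I_disc h N q M \<Delta>\<omega> \<omega> (\<lambda>s. v s y) t) x = I_disc h N q M \<Delta>\<omega> \<omega> (\<lambda>s. A (v s) x) t"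
proof -
  obtain \<kappa> where \<kappa>: "\<And>f t. I_disc h N q M \<Delta>\<omega> \<omega> f t = (\<Sum>n<N. \<kappa> t n * f (real n * h))"
    using I_disc_as_samples by blast
  show ?thesis
    unfolding \<kappa> by (rule linear_operator_lincomb[OF V A _ v x]) simp
qed

lemma I_disc_in_function_space:
  assumes "function_space V" and "\<And>t. v t \<in> V"
  shows "(\<lambda>y. I_disc h N q M \<Delta>\<omega> \<omega> (\<lambda>s. v s y) t) \<in> V"
proof -
  obtain \<kappa> where \<kappa>: "\<And>f t. I_disc h N q M \<Delta>\<omega> \<omega> f t = (\<Sum>n<N. \<kappa> t n * f (real n * h))"
    using I_disc_as_samples by blast
  show ?thesis
    unfolding \<kappa> by (rule function_space_lincomb[OF assms(1) _ assms(2)]) simp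
qed

lemma exponential_sum_has_vector_derivative:
  fixes a t :: real and \<beta> F d :: "nat \<Rightarrow> complex"
  shows "((\<lambda>t. a * (\<Sum>m<M. \<beta> m ^ j * F m * exp (\<beta> m * of_real t) * d m))
    has_vector_derivative
    a * (\<Sum>m<M. \<beta> m ^ Suc j * F m * exp (\<beta> m * of_real t) * d m)) (at t)"
proof -
  have "((\<lambda>z. a * (\<Sum>m<M. \<beta> m ^ j * F m * exp (\<beta> m * z) * d m)) has_field_derivative
    a * (\<Sum>m<M. \<beta> m ^ Suc j * F m * exp (\<beta> m * of_real t) * d m)) (at (of_real t))"
    by (auto intro!: derivative_eq_intros sum.cong simp: mult_ac)
  then show ?thesis by (rule has_vector_derivative_real_field)
qed

text \<open>
  \<^const>\<open>I_disc\<close> synthesises with the exponentials of frequency \<open>q \<xi>\<close>, so that time derivatives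
  produce the same factors as differences do on the grid.
\<close>
lemma time_deriv_I_disc:
  "time_deriv j (I_disc h N q M \<Delta>\<omega> \<omega> f) = (\<lambda>t. \<Delta>\<omega> * (\<Sum>m<M. (2 * pi * \<i> * q (\<omega> m)) ^ j
     * sampled_fourier h N f (\<omega> m) * exp (2 * pi * \<i> * q (\<omega> m) * t) * deriv q (\<omega> m)))"
proof (induction j)
  case 0
  show ?case by (simp add: time_deriv_def I_disc_def fun_eq_iff)
next
  case (Suc j)
  have "time_deriv (Suc j) (I_disc h N q M \<Delta>\<omega> \<omega> f)
      = (\<lambda>t. vector_derivative (time_deriv j (I_disc h N q M \<Delta>\<omega> \<omega> f)) (at t))"
    by (simp add: time_deriv_def)
  then show ?case
    by (simp only: Suc vector_derivative_at[OF exponential_sum_has_vector_derivative])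
qed

lemma times_differentiable_on_I_disc: "times_differentiable_on n (I_disc h N q M \<Delta>\<omega> \<omega> f) I"
  unfolding times_differentiable_on_def time_deriv_I_disc
proof (intro allI impI ballI)
  fix j and t :: real
  show "(\<lambda>t::real. \<Delta>\<omega> * (\<Sum>m<M. (2 * pi * \<i> * q (\<omega> m)) ^ j
     * sampled_fourier h N f (\<omega> m) * exp (2 * pi * \<i> * q (\<omega> m) * t) * deriv q (\<omega> m))) differentiable at t"
    by (rule differentiableI_vector, rule exponential_sum_has_vector_derivative)
qed

text \<open>
  The finite difference system in the frequency domain: the difference operators are replaced by
  powers of their symbol. Each difference is summed over the whole grid; their total equals the
  source in the window and vanishes outside it, so its sum is the windowed transform of the source.
\<close>
lemma grid_system_sampled_fourier:
  fixes v g :: "'k::finite \<Rightarrow> real \<Rightarrow> 'a \<Rightarrow> complex"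
  assumes Z: "finite Z" and grid: "grid_system X V Z ord L"
    and V: "\<And>k. function_space (V k)"
    and L: "\<And>j k. j < ord i \<Longrightarrow> linear_operator X (V k) (L i j k)"
    and v: "\<And>k t. v k t \<in> V k"
    and outside: "\<And>k n y. y \<in> X \<Longrightarrow> n < 0 \<or> int N \<le> n \<Longrightarrow> v k (real_of_int n * h) y = 0"
    and eq: "\<And>n. n < N \<Longrightarrow> fd_op Z c h ord L i v (real n * h) x = g i (real n * h) x"
    and no_source: "\<And>n. n < 0 \<or> int N \<le> n \<Longrightarrow> fd_op Z c h ord L i v (real_of_int n * h) x = 0"
    and x: "x \<in> X"
  shows "(2 * pi * \<i> * phase_symbol Z c h \<xi>) ^ ord i * sampled_fourier h N (\<lambda>s. v i s x) \<xi>
    + (\<Sum>j<ord i. \<Sum>k\<in>UNIV. (2 * pi * \<i> * phase_symbol Z c h \<xi>) ^ j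
         * sampled_fourier h N (\<lambda>s. L i j k (v k s) x) \<xi>)
    = sampled_fourier h N (\<lambda>s. g i s x) \<xi>" (is "?lhs = _")
proof -
  let ?e = "\<lambda>n::int. exp (- 2 * pi * \<i> * of_int n * h * \<xi>)"
  let ?\<sigma> = "2 * pi * \<i> * phase_symbol Z c h \<xi>"
  have lower: "((\<lambda>n::int. h * ((fd_deriv Z c h ^^ j) (\<lambda>s. L i j k (v k s) x) (real_of_int n * h)
        * ?e n))
      has_sum ?\<sigma> ^ j * sampled_fourier h N (\<lambda>s. L i j k (v k s) x) \<xi>) UNIV" if j: "j < ord i" for j k
  proof (cases "offsets Z j \<subseteq> \<int>")
    case True
    show ?thesis
      using linear_operator_zero[OF V L[OF j] v outside x]
      by (intro fd_deriv_funpow_has_sum[OF Z True]) blast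
  next
    \<comment> \<open>Differences that leave the grid occur only together with a vanishing operator.\<close>
    case False
    then have "L i j k (v k s) x = 0" for s
      using grid j v x unfolding grid_system_def by blast
    moreover have "(fd_deriv Z c h ^^ j) (\<lambda>s. 0) t = 0" for t
      using fd_deriv_funpow_expansion[OF Z, where c = c and h = h and j = j] by auto
    ultimately show ?thesis by (simp add: sampled_fourier_def)
  qed
  have "((\<lambda>n::int. h * ((fd_deriv Z c h ^^ ord i) (\<lambda>s. v i s x) (real_of_int n * h) * ?e n)
      + (\<Sum>j<ord i. \<Sum>k\<in>UNIV. h * ((fd_deriv Z c h ^^ j) (\<lambda>s. L i j k (v k s) x)
          (real_of_int n * h) * ?e n)))
      has_sum ?lhs) UNIV"
    using grid outside[OF x] unfolding grid_system_def
    by (intro has_sum_add has_sum_finite_sum fd_deriv_funpow_has_sum[OF Z] lower) auto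
  then have "((\<lambda>n::int. h * (fd_op Z c h ord L i v (real_of_int n * h) x * ?e n)) has_sum ?lhs) UNIV"
    by (simp add: fd_op_def sum_distrib_left sum_distrib_right distrib_left distrib_right mult_ac)
  moreover have "((\<lambda>n::int. h * (fd_op Z c h ord L i v (real_of_int n * h) x * ?e n))
      has_sum sampled_fourier h N (\<lambda>t. fd_op Z c h ord L i v t x) \<xi>) UNIV"
    by (rule sampled_fourier_has_sum) (rule no_source)
  ultimately have "?lhs = sampled_fourier h N (\<lambda>t. fd_op Z c h ord L i v t x) \<xi>"
    by (rule has_sum_unique)
  also have "sampled_fourier h N (\<lambda>t. fd_op Z c h ord L i v t x) \<xi>
      = sampled_fourier h N (\<lambda>s. g i s x) \<xi>"
    by (simp add: sampled_fourier_def eq)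
  finally show ?thesis .
qed


section \<open>The transformed solution solves the evolution equation\<close>

theorem theorem2p10:
  fixes X :: "(real ^ 'd) set"
    and V :: "'k::finite \<Rightarrow> (real ^ 'd \<Rightarrow> complex) set"
    and ord :: "'k \<Rightarrow> nat"
    and L :: "'k \<Rightarrow> nat \<Rightarrow> 'k \<Rightarrow> (real ^ 'd \<Rightarrow> complex) \<Rightarrow> real ^ 'd \<Rightarrow> complex"
    and Z :: "real set" and c :: "real \<Rightarrow> complex"
    and T h \<Delta>\<omega> :: real and N M :: nat
    and q :: "real \<Rightarrow> real" and \<Omega> :: "real set" and \<omega> :: "nat \<Rightarrow> real"
    and f_orig g v u :: "'k \<Rightarrow> real \<Rightarrow> real ^ 'd \<Rightarrow> complex"
  assumes "0 < T" and "0 < N" and h: "h = T / real N"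
    and "\<And>k. function_space (V k)"
    and "\<And>i j k. j < ord i \<Longrightarrow> linear_operator X (V k) (L i j k)"
    and "finite Z"
    and grid: "grid_system X V Z ord L"
    and q: "\<And>\<xi>. complex_of_real (q \<xi>) = phase_symbol Z c h \<xi>"
    and "phase_domain q \<Omega>"
    and "uniform_partition \<Omega> M \<Delta>\<omega> \<omega>"
    and "\<And>i t x. x \<in> X \<Longrightarrow> t \<le> 0 \<Longrightarrow> f_orig i t x = 0"
    and g: "\<And>i t x. g i t x = T_disc h N q M \<Delta>\<omega> \<omega> (\<lambda>s. f_orig i s x) t"
    and "\<And>k t. v k t \<in> V k"
    and initial: "\<And>k t x. x \<in> X \<Longrightarrow> t \<le> 0 \<Longrightarrow> v k t x = 0"
    and final: "\<And>k n x. x \<in> X \<Longrightarrow> N \<le> n \<Longrightarrow> v k (real n * h) x = 0"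
    and fd_system: "\<And>i n x. x \<in> X \<Longrightarrow> n < N \<Longrightarrow>
          fd_op Z c h ord L i v (real n * h) x = g i (real n * h) x"
    and no_source_outside: "\<And>i n x. x \<in> X \<Longrightarrow> n < 0 \<or> int N \<le> n \<Longrightarrow>
          fd_op Z c h ord L i v (real_of_int n * h) x = 0"
    and u: "\<And>k t x. u k t x = I_disc h N q M \<Delta>\<omega> \<omega> (\<lambda>s. v k s x) t"
  shows "solves_evolution X V ord L {0<..<T}
    (\<lambda>i t x. I_disc h N q M \<Delta>\<omega> \<omega> (T_disc h N q M \<Delta>\<omega> \<omega> (\<lambda>s. f_orig i s x)) t) u"
proof -
  note V = assms(4) and L = assms(5) and Z = assms(6) and v = assms(13)
  let ?I = "I_disc h N q M \<Delta>\<omega> \<omega>" and ?F = "sampled_fourier h N"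
  have "0 < h" using \<open>0 < T\<close> \<open>0 < N\<close> h by simp
  have outside: "v k (real_of_int n * h) x = 0" if "x \<in> X" "n < 0 \<or> int N \<le> n" for k n x
  proof (cases "n < 0")
    case True
    then show ?thesis
      using initial[OF that(1)] \<open>0 < h\<close> by (simp add: mult_le_0_iff)
  next
    case False
    then show ?thesis using final[OF that(1), of "nat n" k] that(2) by simp
  qed
  have u_eq: "u k t = (\<lambda>x. ?I (\<lambda>s. v k s x) t)" for k t
    using u by blast
  have u_time: "(\<lambda>s. u i s x) = ?I (\<lambda>s. v i s x)" for i x
    unfolding u_eq ..
  have Lu: "(\<lambda>s. L i j k (u k s) x) = ?I (\<lambda>s. L i j k (v k s) x)" if "j < ord i" "x \<in> X" for i j k x
    unfolding u_eq by (intro ext linear_operator_I_disc[where v = "v k", OF V L[OF that(1)] v that(2)])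
  have freq: "(2 * pi * \<i> * q \<xi>) ^ ord i * ?F (\<lambda>s. v i s x) \<xi>
      + (\<Sum>j<ord i. \<Sum>k\<in>UNIV. (2 * pi * \<i> * q \<xi>) ^ j * ?F (\<lambda>s. L i j k (v k s) x) \<xi>)
      = ?F (\<lambda>s. g i s x) \<xi>" if "x \<in> X" for i x \<xi>
    unfolding q
    by (rule grid_system_sampled_fourier[OF Z grid V L v outside fd_system no_source_outside])
      (use that in auto)
  have "evolution_op ord L i u t x = ?I (\<lambda>s. g i s x) t" if x: "x \<in> X" for i t x
  proof -
    \<comment> \<open>The synthesis weights: quadrature step, exponential of the shifted frequency, Jacobian.\<close>
    let ?w = "\<lambda>m. \<Delta>\<omega> * exp (2 * pi * \<i> * q (\<omega> m) * t) * deriv q (\<omega> m)"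
    have D: "time_deriv j (?I f) t = (\<Sum>m<M. ?w m * ((2 * pi * \<i> * q (\<omega> m)) ^ j * ?F f (\<omega> m)))" for j f
      unfolding time_deriv_I_disc sum_distrib_left by (intro sum.cong refl) (simp add: mult_ac)
    have swap: "(\<Sum>j<ord i. \<Sum>k\<in>UNIV. \<Sum>m<M. W m * G j k m)
        = (\<Sum>m<M. W m * (\<Sum>j<ord i. \<Sum>k\<in>UNIV. G j k m))"
      for W :: "nat \<Rightarrow> complex" and G :: "nat \<Rightarrow> 'k \<Rightarrow> nat \<Rightarrow> complex"
    proof -
      have "(\<Sum>j<ord i. \<Sum>k\<in>UNIV. \<Sum>m<M. W m * G j k m)
          = (\<Sum>j<ord i. \<Sum>m<M. \<Sum>k\<in>UNIV. W m * G j k m)"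
        by (intro sum.cong refl) (rule sum.swap)
      also have "\<dots> = (\<Sum>m<M. \<Sum>j<ord i. \<Sum>k\<in>UNIV. W m * G j k m)"
        by (rule sum.swap)
      finally show ?thesis by (simp only: sum_distrib_left)
    qed
    have "evolution_op ord L i u t x = time_deriv (ord i) (?I (\<lambda>s. v i s x)) t
        + (\<Sum>j<ord i. \<Sum>k\<in>UNIV. time_deriv j (?I (\<lambda>s. L i j k (v k s) x)) t)"
      unfolding evolution_op_def by (simp add: Lu[OF _ x] u_time cong: sum.cong_simp)
    also have "\<dots> = (\<Sum>m<M. ?w m * ((2 * pi * \<i> * q (\<omega> m)) ^ ord i * ?F (\<lambda>s. v i s x) (\<omega> m)
      + (\<Sum>j<ord i. \<Sum>k\<in>UNIV. (2 * pi * \<i> * q (\<omega> m)) ^ j * ?F (\<lambda>s. L i j k (v k s) x) (\<omega> m))))"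
      unfolding D swap by (simp only: distrib_left sum.distrib)
    also have "\<dots> = (\<Sum>m<M. ?w m * ?F (\<lambda>s. g i s x) (\<omega> m))"
      unfolding freq[OF x] ..
    also have "\<dots> = ?I (\<lambda>s. g i s x) t"
      using D[of 0] by (simp add: time_deriv_def)
    finally show ?thesis .
  qed
  moreover have "u k t \<in> V k" for k t
    unfolding u_eq by (rule I_disc_in_function_space[OF V v])
  ultimately show ?thesis
    unfolding solves_evolution_def by (simp add: Lu u_time times_differentiable_on_I_disc g)
qed

end
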